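(* Let $0<p<\infty$, $n$ a positive integer, and $A,B\in W^{n-1,q}(D,\mathbb{B})$ with $q>2$. Let $f:D\to\mathbb{B}$ have the representation $$f=\sum_{k=0}^{n-1}(\widehat z+\widehat{z^*})^k\varphi_k,\qquad \varphi_k\in H_{A,B}(D,\mathbb{B}).$$ Then $f\in V^{n,p}_{A,B}(D,\mathbb{B})$ if and only if $\varphi_k\in H^p_{A,B}(D,\mathbb{B})$ for every $k$.
   Context: $D$ is the open unit disk in $\mathbb{C}$. For $u=x+iy\in\mathbb{C}$, $u^*=x-iy$. $\mathbb{B}$ denotes the bicomplex numbers: the commutative $\mathbb{C}$-algebra of elements $z_1+jz_2$ with $z_1,z_2\in\mathbb{C}$, $j^2=-1$, $ij=ji$. Put $p^\pm=\frac12(1\pm ij)$. Each $w=z_1+jz_2\in\mathbb{B}$ is uniquely $w=p^+w^++p^-w^-$ with $w^\pm=z_1\mp iz_2\in\mathbb{C}$, and $\|w\|_{\mathbb{B}}=\sqrt{(|w^+|^2+|w^-|^2)/2}$. Bicomplex conjugation is $\overline{z_1+jz_2}=z_1-jz_2$, and $C(f)=\overline f$. The bicomplexification of $u=x+iy$ is $\widehat u=x+jy\in\mathbb{B}$; thus $\widehat z+\widehat{z^*}=2x$ for $z=x+iy$. $W^{n-1,q}(D,\mathbb{B})$ is the Sobolev space of $\mathbb{B}$-valued functions on $D$ whose components are in the usual Sobolev space $W^{n-1,q}(D)$ (with $W^{0,q}=L^q$). $\bar\partial=\frac12(\partial_x+j\partial_y)$. For $0<p<\infty$, $\|f\|_{H^p_{\mathbb{B}}}=\sup_{0<r<1}\left(\int_0^{2\pi}\|f(re^{i\theta})\|_{\mathbb{B}}^p\,d\theta\right)^{1/p}$.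 $H_{A,B}(D,\mathbb{B})$ is the set of $f:D\to\mathbb{B}$ with $\bar\partial f=Af+B\overline f$, and $H^p_{A,B}(D,\mathbb{B})$ is the subset of those with $\|f\|_{H^p_{\mathbb{B}}}<\infty$. $V^{n,p}_{A,B}(D,\mathbb{B})$ is the set of $f:D\to\mathbb{B}$ with $(\bar\partial-A-BC(\cdot))^nf=0$ and $\sum_{k=0}^{n-1}\|(\bar\partial-A-BC(\cdot))^kf\|_{H^p_{\mathbb{B}}}<\infty$. Derivatives are understood in the weak sense, the iterates being locally integrable functions obtained successively, and solutions and iterates are taken with their continuous representatives. *)

theory Defs
  imports "HOL-Analysis.Analysis"
begin

section \<open>Bicomplex numbers\<close>

text \<open>\<open>Bicomplex z1 z2\<close> stands for \<open>z1 + j z2\<close>.  As for the library's type of complex numbers,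
  a non-recursive codatatype is used only for the sake of its selector equations.\<close>

codatatype bicomplex = Bicomplex (bcfst: complex) (bcsnd: complex)

lemma bicomplex_eq_iff: "w = v \<longleftrightarrow> bcfst w = bcfst v \<and> bcsnd w = bcsnd v"
  by (auto intro: bicomplex.expand)

instantiation bicomplex :: comm_ring_1
begin

primcorec zero_bicomplex where
  "bcfst 0 = 0"
| "bcsnd 0 = 0"

primcorec one_bicomplex where
  "bcfst 1 = 1"
| "bcsnd 1 = 0"

primcorec plus_bicomplex where
  "bcfst (w + v) = bcfst w + bcfst v"
| "bcsnd (w + v) = bcsnd w + bcsnd v"

primcorec uminus_bicomplex where
  "bcfst (- w) = - bcfst w"
| "bcsnd (- w) = - bcsnd w"

primcorec minus_bicomplex where
  "bcfst (w - v) = bcfst w - bcfst v"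
| "bcsnd (w - v) = bcsnd w - bcsnd v"

primcorec times_bicomplex where
  "bcfst (w * v) = bcfst w * bcfst v - bcsnd w * bcsnd v"
| "bcsnd (w * v) = bcfst w * bcsnd v + bcsnd w * bcfst v"

instance
  by standard (simp_all add: bicomplex_eq_iff algebra_simps)

end

instantiation bicomplex :: real_algebra_1
begin

primcorec scaleR_bicomplex where
  "bcfst (r *\<^sub>R w) = r *\<^sub>R bcfst w"
| "bcsnd (r *\<^sub>R w) = r *\<^sub>R bcsnd w"

instance
  by standard (simp_all add: bicomplex_eq_iff algebra_simps)

end

text \<open>The components \<open>w\<^sup>+\<close> and \<open>w\<^sup>-\<close> of \<open>w = p\<^sup>+ w\<^sup>+ + p\<^sup>- w\<^sup>-\<close>, and the idempotents \<open>p\<^sup>+\<close>, \<open>p\<^sup>-\<close>.\<close>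

definition bcplus :: "bicomplex \<Rightarrow> complex" where
  "bcplus w = bcfst w - \<i> * bcsnd w"

definition bcminus :: "bicomplex \<Rightarrow> complex" where
  "bcminus w = bcfst w + \<i> * bcsnd w"

definition bc_of_complex :: "complex \<Rightarrow> bicomplex" where
  "bc_of_complex c = Bicomplex c 0"

definition bcj :: bicomplex where
  "bcj = Bicomplex 0 1"

definition bc_pplus :: bicomplex where
  "bc_pplus = (1/2) *\<^sub>R (1 + bc_of_complex \<i> * bcj)"

definition bc_pminus :: bicomplex where
  "bc_pminus = (1/2) *\<^sub>R (1 - bc_of_complex \<i> * bcj)"

lemma bicomplex_idempotent_decomposition:
  "w = bc_pplus * bc_of_complex (bcplus w) + bc_pminus * bc_of_complex (bcminus w)"
proof -
  have "(1/2) *\<^sub>R c + (1/2) *\<^sub>R c = c" for c :: complex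
    by (simp flip: scaleR_add_left)
  then show ?thesis
    by (simp add: bicomplex_eq_iff bc_pplus_def bc_pminus_def bc_of_complex_def bcj_def
        bcplus_def bcminus_def complex_eq_iff field_simps)
qed

text \<open>The bicomplex norm is the Euclidean norm of the real space of dimension four, and this is
  what makes the library's Bochner integral applicable to bicomplex-valued functions.  It is
  not submultiplicative, so that \<open>bicomplex\<close> is not in class \<open>real_normed_algebra\<close>.\<close>

instantiation bicomplex :: real_inner
begin

definition norm_bicomplex_def:
  "norm w = sqrt (((norm (bcplus w))\<^sup>2 + (norm (bcminus w))\<^sup>2) / 2)"

definition inner_bicomplex_def:
  "inner w v = inner (bcfst w) (bcfst v) + inner (bcsnd w) (bcsnd v)"

definition sgn_bicomplex_def: "sgn w = w /\<^sub>R norm w" for w :: bicomplex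

definition dist_bicomplex_def: "dist w v = norm (w - v)" for w v :: bicomplex

definition uniformity_bicomplex_def:
  "(uniformity :: (bicomplex \<times> bicomplex) filter) =
    (INF e\<in>{0 <..}. principal {(x, y). dist x y < e})"

definition open_bicomplex_def:
  "open (U :: bicomplex set) \<longleftrightarrow>
    (\<forall>x\<in>U. eventually (\<lambda>(x', y). x' = x \<longrightarrow> y \<in> U) uniformity)"

instance
proof
  fix r :: real and w v u :: bicomplex and S :: "bicomplex set"
  show "dist w v = norm (w - v)" by (rule dist_bicomplex_def)
  show "sgn w = w /\<^sub>R norm w" by (rule sgn_bicomplex_def)
  show "(uniformity :: (bicomplex \<times> bicomplex) filter) =
      (INF e\<in>{0 <..}. principal {(x, y). dist x y < e})"
    by (rule uniformity_bicomplex_def)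
  show "open S \<longleftrightarrow> (\<forall>x\<in>S. eventually (\<lambda>(x', y). x' = x \<longrightarrow> y \<in> S) uniformity)"
    by (rule open_bicomplex_def)
  show "inner w v = inner v w" by (simp add: inner_bicomplex_def inner_commute)
  show "inner (w + v) u = inner w u + inner v u"
    by (simp add: inner_bicomplex_def inner_add_left)
  show "inner (r *\<^sub>R w) v = r * inner w v"
    by (simp add: inner_bicomplex_def algebra_simps)
  show "0 \<le> inner w w" by (simp add: inner_bicomplex_def)
  show "inner w w = 0 \<longleftrightarrow> w = 0"
    by (simp add: inner_bicomplex_def bicomplex_eq_iff add_nonneg_eq_0_iff)
  show "norm w = sqrt (inner w w)"
  proof -
    have "(norm (a - \<i> * b))\<^sup>2 + (norm (a + \<i> * b))\<^sup>2 = 2 * (inner a a + inner b b)" for a b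
      unfolding cmod_power2 inner_complex_def by (simp add: power2_eq_square algebra_simps)
    then show ?thesis
      by (simp add: norm_bicomplex_def inner_bicomplex_def bcplus_def bcminus_def)
  qed
qed

end

instantiation bicomplex :: euclidean_space
begin

definition Basis_bicomplex_def:
  "Basis = {Bicomplex 1 0, Bicomplex \<i> 0, Bicomplex 0 1, Bicomplex 0 \<i>}"

instance
proof
  fix u v w :: bicomplex
  show "(Basis :: bicomplex set) \<noteq> {}" "finite (Basis :: bicomplex set)"
    by (simp_all add: Basis_bicomplex_def)
  show "inner u v = (if u = v then 1 else 0)" if "u \<in> Basis" "v \<in> Basis"
    using that unfolding Basis_bicomplex_def insert_iff empty_iff
    by (elim disjE) (simp_all add: inner_bicomplex_def)
  show "(\<forall>u\<in>Basis. inner w u = 0) \<longleftrightarrow> w = 0"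
    by (simp add: Basis_bicomplex_def inner_bicomplex_def bicomplex_eq_iff complex_eq_iff)
qed

end

definition bccnj :: "bicomplex \<Rightarrow> bicomplex" where
  "bccnj w = Bicomplex (bcfst w) (- bcsnd w)"

text \<open>The bicomplexification \<open>x + j y\<close> of \<open>x + \<i> y\<close>.\<close>

definition bchat :: "complex \<Rightarrow> bicomplex" where
  "bchat u = Bicomplex (of_real (Re u)) (of_real (Im u))"

section \<open>Weak derivatives on the unit disk\<close>

text \<open>Functions on the disk are total functions on \<^typ>\<open>complex\<close>; everything below depends on
  their restriction to the disk only.\<close>

abbreviation udisk :: "complex set" where
  "udisk \<equiv> ball 0 1"

definition dx :: "(complex \<Rightarrow> real) \<Rightarrow> complex \<Rightarrow> real" where
  "dx \<phi> z = frechet_derivative \<phi> (at z) 1"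

definition dy :: "(complex \<Rightarrow> real) \<Rightarrow> complex \<Rightarrow> real" where
  "dy \<phi> z = frechet_derivative \<phi> (at z) \<i>"

primrec C_diff :: "nat \<Rightarrow> (complex \<Rightarrow> real) \<Rightarrow> bool" where
  "C_diff 0 \<phi> \<longleftrightarrow> continuous_on UNIV \<phi>"
| "C_diff (Suc m) \<phi> \<longleftrightarrow> (\<forall>z. \<phi> differentiable (at z)) \<and> C_diff m (dx \<phi>) \<and> C_diff m (dy \<phi>)"

definition test_function :: "(complex \<Rightarrow> real) \<Rightarrow> bool" where
  "test_function \<phi> \<longleftrightarrow> (\<forall>m. C_diff m \<phi>) \<and>
    (\<exists>K. compact K \<and> K \<subseteq> udisk \<and> (\<forall>z. z \<notin> K \<longrightarrow> \<phi> z = 0))"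

definition loc_integrable :: "(complex \<Rightarrow> 'b::{banach, second_countable_topology}) \<Rightarrow> bool" where
  "loc_integrable u \<longleftrightarrow> (\<forall>K. compact K \<longrightarrow> K \<subseteq> udisk \<longrightarrow> set_integrable lebesgue K u)"

definition has_weak_partial ::
    "nat \<Rightarrow> nat \<Rightarrow> (complex \<Rightarrow> complex) \<Rightarrow> (complex \<Rightarrow> complex) \<Rightarrow> bool" where
  "has_weak_partial a b u g \<longleftrightarrow> loc_integrable u \<and> loc_integrable g \<and>
    (\<forall>\<phi>. test_function \<phi> \<longrightarrow>
      (LINT z:udisk|lebesgue. (dx ^^ a) ((dy ^^ b) \<phi>) z *\<^sub>R u z) =
        (-1) ^ (a + b) * (LINT z:udisk|lebesgue. \<phi> z *\<^sub>R g z))"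

definition Lq_disk :: "real \<Rightarrow> (complex \<Rightarrow> complex) set" where
  "Lq_disk q = {u. u \<in> borel_measurable (lebesgue_on udisk) \<and>
    integrable (lebesgue_on udisk) (\<lambda>z. norm (u z) powr q)}"

definition Sobolev :: "nat \<Rightarrow> real \<Rightarrow> (complex \<Rightarrow> complex) set" where
  "Sobolev m q = {u \<in> Lq_disk q.
    \<forall>a b. a + b \<le> m \<longrightarrow> (\<exists>g \<in> Lq_disk q. has_weak_partial a b u g)}"

definition Sobolev_bc :: "nat \<Rightarrow> real \<Rightarrow> (complex \<Rightarrow> bicomplex) set" where
  "Sobolev_bc m q = {A. (\<lambda>z. bcfst (A z)) \<in> Sobolev m q \<and> (\<lambda>z. bcsnd (A z)) \<in> Sobolev m q}"

definition dbar :: "(complex \<Rightarrow> real) \<Rightarrow> complex \<Rightarrow> bicomplex" where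
  "dbar \<phi> z = (1/2) *\<^sub>R (of_real (dx \<phi> z) + bcj * of_real (dy \<phi> z))"

text \<open>The equation \<open>\<partial>\<bar> f = h\<close> in the weak sense; the individual weak partial derivatives of \<open>f\<close>
  are not required to be functions.\<close>

definition has_weak_dbar :: "(complex \<Rightarrow> bicomplex) \<Rightarrow> (complex \<Rightarrow> bicomplex) \<Rightarrow> bool" where
  "has_weak_dbar f h \<longleftrightarrow> loc_integrable f \<and> loc_integrable h \<and>
    (\<forall>\<phi>. test_function \<phi> \<longrightarrow>
      (LINT z:udisk|lebesgue. dbar \<phi> z * f z) = - (LINT z:udisk|lebesgue. \<phi> z *\<^sub>R h z))"

text \<open>\<open>vekua_op A B f g\<close> says \<open>(\<partial>\<bar> - A - B C(\<cdot>)) f = g\<close>, written as \<open>\<partial>\<bar> f = g + A f + B C(f)\<close>.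
  The operator is a relation since \<open>g\<close> is determined almost everywhere only.\<close>

definition vekua_op ::
    "(complex \<Rightarrow> bicomplex) \<Rightarrow> (complex \<Rightarrow> bicomplex) \<Rightarrow>
     (complex \<Rightarrow> bicomplex) \<Rightarrow> (complex \<Rightarrow> bicomplex) \<Rightarrow> bool" where
  "vekua_op A B f g \<longleftrightarrow> has_weak_dbar f (\<lambda>z. g z + A z * f z + B z * bccnj (f z))"

section \<open>Hardy classes\<close>

definition ennreal_powr :: "ennreal \<Rightarrow> real \<Rightarrow> ennreal" where
  "ennreal_powr x s = (if x = \<infinity> then \<infinity> else ennreal (enn2real x powr s))"

text \<open>A quasi-norm only, if \<open>p < 1\<close>; the value \<open>\<infinity>\<close> is allowed.\<close>

definition Hp_norm :: "real \<Rightarrow> (complex \<Rightarrow> bicomplex) \<Rightarrow> ennreal" where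
  "Hp_norm p f = (SUP r\<in>{0<..<1}. ennreal_powr
     (\<integral>\<^sup>+\<theta>\<in>{0..2*pi}. ennreal (norm (f (of_real r * cis \<theta>)) powr p) \<partial>lborel) (1/p))"

text \<open>Solutions are taken with their continuous representatives.\<close>

definition H_space ::
    "(complex \<Rightarrow> bicomplex) \<Rightarrow> (complex \<Rightarrow> bicomplex) \<Rightarrow> (complex \<Rightarrow> bicomplex) set" where
  "H_space A B = {f. continuous_on udisk f \<and>
    has_weak_dbar f (\<lambda>z. A z * f z + B z * bccnj (f z))}"

definition Hp_space ::
    "real \<Rightarrow> (complex \<Rightarrow> bicomplex) \<Rightarrow> (complex \<Rightarrow> bicomplex) \<Rightarrow> (complex \<Rightarrow> bicomplex) set" where
  "Hp_space p A B = {f \<in> H_space A B. Hp_norm p f < \<infinity>}"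

text \<open>In the following definition \<open>g k\<close> is the \<open>k\<close>-th iterate \<open>(\<partial>\<bar> - A - B C(\<cdot>))\<^sup>k f\<close>, again with its
  continuous representative; these iterates are unique on the disk.\<close>

definition V_space ::
    "nat \<Rightarrow> real \<Rightarrow> (complex \<Rightarrow> bicomplex) \<Rightarrow> (complex \<Rightarrow> bicomplex) \<Rightarrow> (complex \<Rightarrow> bicomplex) set"
  where
  "V_space n p A B = {f. \<exists>g :: nat \<Rightarrow> complex \<Rightarrow> bicomplex.
     (\<forall>z\<in>udisk. g 0 z = f z) \<and>
     (\<forall>k<n. continuous_on udisk (g k) \<and> vekua_op A B (g k) (g (Suc k))) \<and>
     (\<forall>z\<in>udisk. g n z = 0) \<and>
     (\<Sum>k<n. Hp_norm p (g k)) < \<infinity>}"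

end

theory Submission
  imports Defs
begin

text \<open>
  Write \<open>T = \<partial>\<bar> - A - B C(\<cdot>)\<close>.  On the disk \<open>bchat z + bchat (cnj z)\<close> is the real number \<open>2 x\<close>, where
  \<open>x = Re z\<close>, and \<open>\<partial>\<bar> (2 x) = 1\<close>.  A real factor commutes with multiplication by \<open>A\<close>, by \<open>B\<close> and with
  conjugation, so for a solution of \<open>T \<phi> = 0\<close> the Leibniz rule gives
  \<open>T ((2 x)\<^sup>k \<phi>) = k (2 x)\<^sup>k\<^sup>-\<^sup>1 \<phi>\<close>: the operator acts on a polynomial in \<open>2 x\<close> with solutions as coefficients
  like formal differentiation.  Hence \<open>T\<^sup>m f\<close> is the sum of \<open>(k + m)! / k! (2 x)\<^sup>k \<phi>\<^bsub>k+m\<^esub>\<close> over \<open>k < n - m\<close>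
  (\<open>vekua_op_iterate\<close>), and in particular \<open>T\<^sup>n f = 0\<close>.

  The linear system that expresses \<open>f, T f, \<dots>, T\<^sup>n\<^sup>-\<^sup>1 f\<close> by \<open>\<phi>\<^sub>0, \<dots>, \<phi>\<^sub>n\<^sub>-\<^sub>1\<close> is triangular; its diagonal entries
  are the constants \<open>m!\<close>, and the others are bounded because \<open>\<bar>2 x\<bar> \<le> 2\<close> on the disk.  Continuous functions with
  finite Hardy norm are closed under addition and under multiplication by bounded real functions,
  for \<open>p < 1\<close> as well, so all iterates have finite norm if and only if all \<open>\<phi>\<^sub>k\<close> have
  (\<open>Hp_norm_vekua_iterate_finite_iff\<close>).

  Membership in \<open>V_space\<close> only provides some family of continuous iterates.  That it agrees with the
  explicit one (\<open>vekua_op_unique\<close>) is the fundamental lemma of the calculus of variations, for which a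
  smooth bump function is constructed.
\<close>

section \<open>Smooth functions\<close>

lemma dx_eqI: "(\<phi> has_derivative D) (at z) \<Longrightarrow> dx \<phi> z = D 1"
  and dy_eqI: "(\<phi> has_derivative D) (at z) \<Longrightarrow> dy \<phi> z = D \<i>"
  by (simp_all add: dx_def dy_def frechet_derivative_at[symmetric])

lemma C_diff_Suc_imp_C_diff: "C_diff (Suc m) \<phi> \<Longrightarrow> C_diff m \<phi>"
proof (induction m arbitrary: \<phi>)
  case 0
  then show ?case
    by (simp add: differentiable_imp_continuous_within continuous_at_imp_continuous_on)
next
  case (Suc m)
  from Suc.prems have "\<forall>z. \<phi> differentiable at z" "C_diff (Suc m) (dx \<phi>)" "C_diff (Suc m) (dy \<phi>)"
    by simp_all
  with Suc.IH show ?case by (simp del: C_diff.simps(2) add: C_diff.simps(2)[of m \<phi>])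
qed

lemma C_diff_imp_continuous_on: "C_diff m \<phi> \<Longrightarrow> continuous_on S \<phi>"
proof (induction m)
  case 0
  then show ?case by (auto intro: continuous_on_subset)
qed (blast dest: C_diff_Suc_imp_C_diff)

lemma C_diff_const: "C_diff m (\<lambda>_. c)"
proof (induction m arbitrary: c)
  case (Suc m)
  have "dx (\<lambda>_. c) = (\<lambda>_. 0)" "dy (\<lambda>_. c) = (\<lambda>_. 0)"
    by (auto intro!: ext dx_eqI[THEN trans] dy_eqI[THEN trans] derivative_eq_intros)
  with Suc show ?case by simp
qed simp

lemma C_diff_Re: "C_diff m Re" and C_diff_Im: "C_diff m Im"
proof -
  have Re: "(Re has_derivative Re) (at z)" and Im: "(Im has_derivative Im) (at z)" for z
    by (rule bounded_linear_imp_has_derivative bounded_linear_Re bounded_linear_Im)+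
  have "dx Re = (\<lambda>_. 1)" "dy Re = (\<lambda>_. 0)" "dx Im = (\<lambda>_. 0)" "dy Im = (\<lambda>_. 1)"
    using dx_eqI[OF Re] dy_eqI[OF Re] dx_eqI[OF Im] dy_eqI[OF Im] by auto
  then show "C_diff m Re" "C_diff m Im"
    using Re Im by (cases m; auto simp: C_diff_const differentiable_def intro!: continuous_intros)+
qed

lemma dx_dy_add:
  assumes "\<phi> differentiable at z" "\<psi> differentiable at z"
  shows "dx (\<lambda>z. \<phi> z + \<psi> z) z = dx \<phi> z + dx \<psi> z" "dy (\<lambda>z. \<phi> z + \<psi> z) z = dy \<phi> z + dy \<psi> z"
  using has_derivative_add[OF assms[unfolded frechet_derivative_works]]
  by (auto dest: dx_eqI dy_eqI simp: dx_def dy_def)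

lemma dx_dy_mult:
  assumes "\<phi> differentiable at z" "\<psi> differentiable at z"
  shows "dx (\<lambda>z. \<phi> z * \<psi> z) z = \<phi> z * dx \<psi> z + dx \<phi> z * \<psi> z"
    "dy (\<lambda>z. \<phi> z * \<psi> z) z = \<phi> z * dy \<psi> z + dy \<phi> z * \<psi> z"
  using has_derivative_mult[OF assms[unfolded frechet_derivative_works]]
  by (auto dest: dx_eqI dy_eqI simp: dx_def dy_def)

lemma C_diff_add: "C_diff m \<phi> \<Longrightarrow> C_diff m \<psi> \<Longrightarrow> C_diff m (\<lambda>z. \<phi> z + \<psi> z)"
proof (induction m arbitrary: \<phi> \<psi>)
  case (Suc m)
  then have "dx (\<lambda>z. \<phi> z + \<psi> z) = (\<lambda>z. dx \<phi> z + dx \<psi> z)"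
    "dy (\<lambda>z. \<phi> z + \<psi> z) = (\<lambda>z. dy \<phi> z + dy \<psi> z)"
    by (auto intro!: ext dx_dy_add)
  with Suc show ?case by (auto intro: derivative_intros)
qed (auto intro: continuous_intros)

lemma C_diff_mult: "C_diff m \<phi> \<Longrightarrow> C_diff m \<psi> \<Longrightarrow> C_diff m (\<lambda>z. \<phi> z * \<psi> z)"
proof (induction m arbitrary: \<phi> \<psi>)
  case (Suc m)
  then have "dx (\<lambda>z. \<phi> z * \<psi> z) = (\<lambda>z. \<phi> z * dx \<psi> z + dx \<phi> z * \<psi> z)"
    "dy (\<lambda>z. \<phi> z * \<psi> z) = (\<lambda>z. \<phi> z * dy \<psi> z + dy \<phi> z * \<psi> z)"
    by (auto intro!: ext dx_dy_mult)
  moreover have "C_diff m \<phi>" "C_diff m \<psi>"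
    using Suc.prems by (auto intro: C_diff_Suc_imp_C_diff simp del: C_diff.simps)
  ultimately show ?case using Suc by (auto intro!: C_diff_add intro: derivative_intros)
qed (auto intro: continuous_intros)

lemma C_diff_power: "C_diff m \<phi> \<Longrightarrow> C_diff m (\<lambda>z. \<phi> z ^ l)"
  by (induction l) (simp_all add: C_diff_const C_diff_mult)

text \<open>For \<open>k = 0\<close> this is Cauchy's flat function.  With the powers of \<open>t\<close> in the denominator, the linear
  span of the family is closed under differentiation, and smoothness of all members follows by one
  simultaneous induction.\<close>

definition flat :: "nat \<Rightarrow> real \<Rightarrow> real" where
  "flat k t = (if t > 0 then exp (- (1 / t)) / t ^ k else 0)"

lemma flat_tendsto_0: "(flat k \<longlongrightarrow> 0) (at 0)"
proof -
  have "((\<lambda>s. s ^ k / exp s) \<longlongrightarrow> (0::real)) at_top"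
    by (rule tendsto_power_div_exp_0)
  from filterlim_compose[OF this filterlim_inverse_at_top_right]
  have "((\<lambda>t. inverse t ^ k / exp (inverse t)) \<longlongrightarrow> (0::real)) (at_right 0)" .
  then have "(flat k \<longlongrightarrow> 0) (at_right 0)"
  proof (rule Lim_transform_eventually)
    show "\<forall>\<^sub>F t in at_right 0. inverse t ^ k / exp (inverse t) = flat k t"
      by (auto simp: eventually_at_right_field flat_def exp_minus field_simps intro!: exI[of _ 1])
  qed
  moreover have "(flat k \<longlongrightarrow> 0) (at_left 0)"
    by (rule Lim_transform_eventually[OF tendsto_const])
      (auto simp: eventually_at_left_field flat_def intro!: exI[of _ "-1"])
  ultimately show ?thesis by (simp add: filterlim_at_split)
qed

text \<open>At the origin the difference quotient of \<open>flat k\<close> is \<open>flat (k + 1)\<close>, which tends to 0.\<close>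

lemma flat_has_derivative:
  "(flat k has_real_derivative flat (k + 2) t - real k * flat (k + 1) t) (at t)"
proof -
  consider "t > 0" | "t < 0" | "t = 0" by linarith
  then show ?thesis
  proof cases
    case 1
    have "((\<lambda>t. exp (- (1 / t)) / t ^ k) has_real_derivative
        flat (k + 2) t - real k * flat (k + 1) t) (at t)"
    proof -
      have "real k * t ^ (k - Suc 0) = real k * t ^ k / t"
        using 1 by (cases k) auto
      then show ?thesis
        using 1 by (auto intro!: derivative_eq_intros simp: flat_def divide_simps)
          (auto simp: algebra_simps power2_eq_square power_add)
    qed
    then show ?thesis
      by (rule has_field_derivative_transform_within_open[of _ _ _ "{0<..}"])
        (use 1 in \<open>auto simp: flat_def\<close>)
  next
    case 2
    have "((\<lambda>_. 0) has_real_derivative flat (k + 2) t - real k * flat (k + 1) t) (at t)"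
      using 2 by (simp add: flat_def)
    then show ?thesis
      by (rule has_field_derivative_transform_within_open[of _ _ _ "{..<0}"])
        (use 2 in \<open>auto simp: flat_def\<close>)
  next
    case 3
    have "(flat k (0 + h) - flat k 0) / h = flat (k + 1) h" if "h \<noteq> 0" for h
      using that by (simp add: flat_def)
    with flat_tendsto_0[of "k + 1"] show ?thesis
      unfolding DERIV_def 3
      using LIM_equal[of 0 "\<lambda>h. (flat k (0 + h) - flat k 0) / h" "flat (k + 1)" 0]
      by (simp add: flat_def[of _ 0])
  qed
qed

lemma C_diff_flat: "C_diff m g \<Longrightarrow> C_diff m (\<lambda>z. flat k (g z))"
proof (induction m arbitrary: g k)
  case 0
  have "continuous_on UNIV (flat k)"
    by (meson DERIV_isCont continuous_at_imp_continuous_on flat_has_derivative)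
  with 0 show ?case by (auto intro: continuous_on_compose2)
next
  case (Suc m)
  define g' where "g' z = flat (k + 2) (g z) + (- real k) * flat (k + 1) (g z)" for z
  have "((\<lambda>z. flat k (g z)) has_derivative (\<lambda>h. g' z * frechet_derivative g (at z) h)) (at z)" for z
  proof -
    have "(g has_derivative frechet_derivative g (at z)) (at z)"
      using Suc.prems by (simp flip: frechet_derivative_works)
    from DERIV_compose_FDERIV[OF flat_has_derivative this] show ?thesis
      by (simp add: g'_def mult.commute)
  qed
  note der = this
  have "dx (\<lambda>z. flat k (g z)) = (\<lambda>z. g' z * dx g z)" "dy (\<lambda>z. flat k (g z)) = (\<lambda>z. g' z * dy g z)"
    using dx_eqI[OF der] dy_eqI[OF der] by (auto simp: dx_def dy_def)
  moreover have "C_diff m g" using Suc.prems by (rule C_diff_Suc_imp_C_diff)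
  then have "C_diff m g'"
    unfolding g'_def by (intro C_diff_add C_diff_mult C_diff_const Suc.IH)
  then have "C_diff m (\<lambda>z. g' z * dx g z)" "C_diff m (\<lambda>z. g' z * dy g z)"
    using Suc.prems by (simp_all add: C_diff_mult)
  moreover have "(\<lambda>z. flat k (g z)) differentiable at z" for z
    using der unfolding differentiable_def by blast
  ultimately show ?case by simp
qed

text \<open>The bump is the flat function composed with the polynomial \<open>r\<^sup>2 - \<bar>z - a\<bar>\<^sup>2\<close>, which is positive exactly
  on the ball.\<close>

lemma exists_bump_function:
  assumes "0 < r" "cball a r \<subseteq> udisk"
  obtains \<phi> where "test_function \<phi>" "\<And>z. \<phi> z \<ge> 0" "\<And>z. \<phi> z > 0 \<longleftrightarrow> z \<in> ball a r"
proof
  \<comment> \<open>Only sums and products of constants and coordinates occur, so that the closure properties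
    of \<^const>\<open>C_diff\<close> apply literally.\<close>
  define s where "s z = r\<^sup>2 + (-1) *
    ((Re z + - Re a) * (Re z + - Re a) + (Im z + - Im a) * (Im z + - Im a))" for z
  have s: "s z = r\<^sup>2 - (dist a z)\<^sup>2" for z
    by (simp add: s_def dist_norm cmod_power2) (simp add: power2_eq_square algebra_simps)
  have pos: "s z > 0 \<longleftrightarrow> z \<in> ball a r" for z
    using assms(1) power_mono_iff[of r "dist a z" 2] by (simp add: s flip: not_le)
  have "C_diff m s" for m
    unfolding s_def by (intro C_diff_add C_diff_mult C_diff_const C_diff_Re C_diff_Im)
  then have "C_diff m (\<lambda>z. flat 0 (s z))" for m by (rule C_diff_flat)
  moreover have "flat 0 (s z) = 0" if "z \<notin> cball a r" for z
    using pos[of z] that by (auto simp: flat_def)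
  ultimately show "test_function (\<lambda>z. flat 0 (s z))"
    using assms(2) unfolding test_function_def by (intro conjI allI exI[of _ "cball a r"]) simp_all
  show "flat 0 (s z) \<ge> 0" "flat 0 (s z) > 0 \<longleftrightarrow> z \<in> ball a r" for z
    using pos[of z] by (auto simp: flat_def)
qed

lemma test_function_mult:
  assumes "test_function \<phi>" "\<And>m. C_diff m \<rho>"
  shows "test_function (\<lambda>z. \<rho> z * \<phi> z)"
  using assms C_diff_mult unfolding test_function_def by (metis mult_zero_right)

section \<open>Integration against test functions\<close>

text \<open>The bicomplex norm is not submultiplicative, but in finite dimension every bilinear map is
  bounded, and this is all that integrability of products needs.\<close>

lemma bounded_bilinear_bicomplex_mult: "bounded_bilinear ((*) :: bicomplex \<Rightarrow> bicomplex \<Rightarrow> bicomplex)"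
proof -
  have "bilinear ((*) :: bicomplex \<Rightarrow> bicomplex \<Rightarrow> bicomplex)"
    unfolding bilinear_def
    by (intro conjI allI; rule linearI;
        rule distrib_left distrib_right mult_scaleR_left mult_scaleR_right)
  then show ?thesis by (simp add: bilinear_conv_bounded_bilinear)
qed

lemma loc_integrable_bilinear:
  fixes mul :: "'a::euclidean_space \<Rightarrow> 'b::euclidean_space \<Rightarrow> 'c::euclidean_space"
  assumes "bounded_bilinear mul" "continuous_on UNIV c" "loc_integrable u"
  shows "loc_integrable (\<lambda>z. mul (c z) (u z))"
  unfolding loc_integrable_def
proof (intro allI impI)
  fix K :: "complex set" assume K: "compact K" "K \<subseteq> udisk"
  interpret bounded_bilinear mul by fact
  let ?u = "\<lambda>z. indicat_real K z *\<^sub>R u z"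
  have u: "integrable lebesgue ?u"
    using assms(3) K by (auto simp: loc_integrable_def set_integrable_def)
  obtain L where L: "\<And>z. z \<in> K \<Longrightarrow> norm (c z) \<le> L"
    using compact_imp_bounded[OF compact_continuous_image[OF continuous_on_subset[OF assms(2)] K(1)]]
    unfolding bounded_iff by auto
  obtain M where M: "\<And>a b. norm (mul a b) \<le> norm a * norm b * M" "0 \<le> M"
    using nonneg_bounded by blast
  have "(\<lambda>z. mul (c z) (?u z)) \<in> borel_measurable lebesgue"
  proof (rule borel_measurable_continuous_Pair[where H = mul])
    show "c \<in> borel_measurable lebesgue"
      using borel_measurable_continuous_onI[OF assms(2)] by (simp add: measurable_completion)
    show "?u \<in> borel_measurable lebesgue" using u by simp
    show "continuous_on UNIV (\<lambda>x. mul (fst x) (snd x))"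
      by (rule continuous_on) (intro continuous_intros)+
  qed
  moreover have "norm (mul (c z) (?u z)) \<le> norm ((L * M) *\<^sub>R ?u z)" for z
  proof (cases "z \<in> K")
    case True
    have "norm (mul (c z) (u z)) \<le> L * norm (u z) * M"
      using M(1)[of "c z" "u z"] L[OF True] M(2)
      by (smt (verit) mult_right_mono norm_ge_zero)
    moreover have "0 \<le> L" using L[OF True] norm_ge_zero[of "c z"] by linarith
    ultimately show ?thesis using True M(2) by (simp add: abs_mult mult_ac)
  qed (simp add: zero_right)
  ultimately have "integrable lebesgue (\<lambda>z. mul (c z) (?u z))"
    using Bochner_Integration.integrable_bound[OF integrable_scaleR_right[OF u, of "L * M"]] by blast
  then show "set_integrable lebesgue K (\<lambda>z. mul (c z) (u z))"
    by (simp add: set_integrable_def scaleR_right)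
qed

lemma loc_integrable_cong:
  assumes "\<And>z. z \<in> udisk \<Longrightarrow> u z = v z"
  shows "loc_integrable u \<longleftrightarrow> loc_integrable v"
  unfolding loc_integrable_def using assms
  by (intro all_cong imp_cong refl set_integrable_cong) auto

lemma loc_integrable_add: "loc_integrable u \<Longrightarrow> loc_integrable v \<Longrightarrow> loc_integrable (\<lambda>z. u z + v z)"
  unfolding loc_integrable_def by (blast intro: set_integral_add)

lemma loc_integrable_scaleR:
  "loc_integrable u \<Longrightarrow> loc_integrable (\<lambda>z. c *\<^sub>R u z)"
  unfolding loc_integrable_def by (auto intro: set_integrable_scaleR_right)

lemma set_integrable_test:
  fixes mul :: "'a::euclidean_space \<Rightarrow> 'b::euclidean_space \<Rightarrow> 'c::euclidean_space"
  assumes "bounded_bilinear mul" "continuous_on UNIV c" "loc_integrable u"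
    and "compact K" "K \<subseteq> udisk" "\<And>z. z \<notin> K \<Longrightarrow> c z = 0"
  shows "set_integrable lebesgue udisk (\<lambda>z. mul (c z) (u z))"
proof -
  have "(\<lambda>z. indicat_real udisk z *\<^sub>R mul (c z) (u z)) =
    (\<lambda>z. indicat_real K z *\<^sub>R mul (c z) (u z))"
  proof
    fix z
    show "indicat_real udisk z *\<^sub>R mul (c z) (u z) = indicat_real K z *\<^sub>R mul (c z) (u z)"
      using assms(5,6) bounded_bilinear.zero_left[OF assms(1)] by (cases "z \<in> K") auto
  qed
  moreover have "set_integrable lebesgue K (\<lambda>z. mul (c z) (u z))"
    using loc_integrable_bilinear[OF assms(1-3)] assms(4,5) unfolding loc_integrable_def by blast
  ultimately show ?thesis by (simp add: set_integrable_def)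
qed

lemma continuous_on_dbar:
  assumes "\<And>m. C_diff m \<phi>"
  shows "continuous_on UNIV (dbar \<phi>)"
proof -
  have cont: "continuous_on UNIV (dx \<phi>)" "continuous_on UNIV (dy \<phi>)" using assms[of 1] by simp_all
  have "bounded_linear (\<lambda>t. bcj * of_real t)"
    by (rule linear_conv_bounded_linear[THEN iffD1], rule linearI)
      (simp_all add: of_real_def distrib_left scaleR_add_left)
  from bounded_linear.continuous_on[OF this cont(2)] cont(1) show ?thesis
    unfolding dbar_def[abs_def] by (intro continuous_on_scaleR continuous_on_add
        continuous_on_const continuous_on_of_real)
qed

lemma dbar_mult:
  assumes "\<phi> differentiable at z" "\<psi> differentiable at z"
  shows "dbar (\<lambda>z. \<phi> z * \<psi> z) z = \<phi> z *\<^sub>R dbar \<psi> z + \<psi> z *\<^sub>R dbar \<phi> z"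
  by (simp add: dbar_def dx_dy_mult[OF assms] of_real_def algebra_simps)

lemma test_function_support:
  assumes "test_function \<phi>"
  obtains K where "compact K" "K \<subseteq> udisk" "\<And>z. z \<notin> K \<Longrightarrow> \<phi> z = 0" "\<And>z. z \<notin> K \<Longrightarrow> dbar \<phi> z = 0"
    "continuous_on UNIV \<phi>" "continuous_on UNIV (dbar \<phi>)"
proof -
  obtain K where K: "compact K" "K \<subseteq> udisk" "\<And>z. z \<notin> K \<Longrightarrow> \<phi> z = 0"
    using assms by (auto simp: test_function_def)
  have "dbar \<phi> z = 0" if "z \<notin> K" for z
  proof -
    have "(\<phi> has_derivative (\<lambda>_. 0)) (at z)"
      by (rule has_derivative_transform_within_open[OF has_derivative_const, where s="- K"])
        (use K that in \<open>auto intro: open_Compl compact_imp_closed\<close>)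
    then show ?thesis using dx_eqI dy_eqI by (simp add: dbar_def)
  qed
  moreover have "C_diff m \<phi>" for m using assms by (simp add: test_function_def)
  ultimately show ?thesis
    by (intro that[OF K] continuous_on_dbar C_diff_imp_continuous_on[of 0]) auto
qed

lemma integrable_test:
  fixes u :: "complex \<Rightarrow> bicomplex"
  assumes "test_function \<phi>" "loc_integrable u"
  shows "set_integrable lebesgue udisk (\<lambda>z. \<phi> z *\<^sub>R u z)"
    "set_integrable lebesgue udisk (\<lambda>z. dbar \<phi> z * u z)"
  using assms(1)
  by (rule test_function_support, blast intro: set_integrable_test[OF bounded_bilinear_scaleR]
    set_integrable_test[OF bounded_bilinear_bicomplex_mult] assms(2))+

text \<open>If \<open>u a \<noteq> 0\<close>, the inner product of \<open>u\<close> with \<open>u a\<close> is positive on a small ball around \<open>a\<close>, and so is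
  its integral against a bump function of that ball.\<close>

lemma continuous_eq_0_if_test_integrals_0:
  fixes u :: "complex \<Rightarrow> bicomplex"
  assumes "continuous_on udisk u" "loc_integrable u"
    and zero: "\<And>\<phi>. test_function \<phi> \<Longrightarrow> (LINT z:udisk|lebesgue. \<phi> z *\<^sub>R u z) = 0"
    and "a \<in> udisk"
  shows "u a = 0"
proof (rule ccontr)
  assume "u a \<noteq> 0"
  define s where "s z = u z \<bullet> u a" for z
  have "continuous_on udisk s" unfolding s_def by (intro continuous_intros assms)
  moreover have "s a > 0" using \<open>u a \<noteq> 0\<close> by (simp add: s_def)
  moreover have "open (udisk :: complex set)" by simp
  ultimately have "open (s -` {0<..} \<inter> udisk)"
    by (auto intro: continuous_open_preimage simp: Int_commute)
  then obtain d where d: "d > 0" "\<And>z. dist z a < d \<Longrightarrow> s z > 0"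
    using \<open>s a > 0\<close> \<open>a \<in> udisk\<close> unfolding open_dist by force
  obtain e where e: "e > 0" "cball a e \<subseteq> udisk"
    using \<open>a \<in> udisk\<close> by (meson open_ball open_contains_cball)
  define r where "r = min d e"
  have r: "r > 0" "cball a r \<subseteq> udisk" "\<And>z. z \<in> ball a r \<Longrightarrow> s z > 0"
    using d e by (auto simp: r_def dist_commute)
  obtain \<phi> where \<phi>: "test_function \<phi>" "\<And>z. \<phi> z \<ge> 0" "\<And>z. \<phi> z > 0 \<longleftrightarrow> z \<in> ball a r"
    using exists_bump_function[OF r(1,2)] by metis
  define w where "w z = indicator udisk z *\<^sub>R \<phi> z *\<^sub>R u z" for z
  have w: "integrable lebesgue w" "integral\<^sup>L lebesgue w = 0"
    using integrable_test(1)[OF \<phi>(1) assms(2)] zero[OF \<phi>(1)]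
    unfolding w_def set_integrable_def set_lebesgue_integral_def by auto
  have nonneg: "w z \<bullet> u a \<ge> 0" and pos: "z \<in> ball a r \<Longrightarrow> w z \<bullet> u a > 0" for z
  proof -
    have *: "w z \<bullet> u a = indicator udisk z * (\<phi> z * s z)" by (simp add: w_def s_def)
    show "z \<in> ball a r \<Longrightarrow> w z \<bullet> u a > 0"
      using r \<phi>(3)[of z] unfolding * by (auto simp: indicator_def subset_iff dist_norm)
    moreover have "\<phi> z = 0" if "z \<notin> ball a r" using \<phi>(2,3)[of z] that by linarith
    ultimately show "w z \<bullet> u a \<ge> 0"
      unfolding * by (metis less_imp_le mult_zero_left mult_zero_right order_refl * )
  qed
  have "integral\<^sup>L lebesgue (\<lambda>z. w z \<bullet> u a) = 0"
    using w by (simp add: integral_inner_left)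
  then have "AE z in lebesgue. w z \<bullet> u a = 0"
    using integral_nonneg_eq_0_iff_AE[OF integrable_inner_left[OF w(1)]] nonneg by simp
  then have "AE z in lebesgue. z \<notin> ball a r"
    by eventually_elim (use pos in force)
  then have "emeasure lebesgue (ball a r) = 0"
    by (subst (asm) AE_iff_measurable[of "ball a r"]) auto
  moreover have "emeasure lebesgue (ball a r) = emeasure lborel (ball a r)" by simp
  ultimately show False using r(1)
    by (metis open_ball open_not_negligible negligible_iff_emeasure0 ball_eq_empty
        fmeasurableD lmeasurable_ball not_le)
qed

section \<open>Weak solutions\<close>

lemma has_weak_dbar_cong:
  assumes "\<And>z. z \<in> udisk \<Longrightarrow> f z = f' z" "\<And>z. z \<in> udisk \<Longrightarrow> h z = h' z"
  shows "has_weak_dbar f h \<longleftrightarrow> has_weak_dbar f' h'"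
proof -
  have "(LINT z:udisk|lebesgue. dbar \<phi> z * f z) = (LINT z:udisk|lebesgue. dbar \<phi> z * f' z)"
    "(LINT z:udisk|lebesgue. \<phi> z *\<^sub>R h z) = (LINT z:udisk|lebesgue. \<phi> z *\<^sub>R h' z)" for \<phi>
    using assms by (auto intro!: set_lebesgue_integral_cong)
  moreover have "loc_integrable f = loc_integrable f'" "loc_integrable h = loc_integrable h'"
    using assms by (auto intro!: loc_integrable_cong)
  ultimately show ?thesis by (simp add: has_weak_dbar_def)
qed

lemma has_weak_dbar_add:
  assumes "has_weak_dbar f h" "has_weak_dbar f' h'"
  shows "has_weak_dbar (\<lambda>z. f z + f' z) (\<lambda>z. h z + h' z)"
proof -
  have li: "loc_integrable f" "loc_integrable h" "loc_integrable f'" "loc_integrable h'"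
    using assms by (auto simp: has_weak_dbar_def)
  have "(LINT z:udisk|lebesgue. dbar \<phi> z * (f z + f' z)) =
      - (LINT z:udisk|lebesgue. \<phi> z *\<^sub>R (h z + h' z))" if "test_function \<phi>" for \<phi>
    using assms that integrable_test[OF that li(1)] integrable_test[OF that li(2)]
      integrable_test[OF that li(3)] integrable_test[OF that li(4)]
    by (simp add: distrib_left scaleR_add_right has_weak_dbar_def set_integral_add)
  then show ?thesis
    using li by (simp add: has_weak_dbar_def loc_integrable_add)
qed

lemma has_weak_dbar_scaleR:
  assumes "has_weak_dbar f h"
  shows "has_weak_dbar (\<lambda>z. c *\<^sub>R f z) (\<lambda>z. c *\<^sub>R h z)"
  using assms
  by (simp add: has_weak_dbar_def loc_integrable_scaleR scaleR_left_commute[of _ c] del: scaleR_scaleR)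

lemma has_weak_dbar_0: "has_weak_dbar (\<lambda>_. 0) (\<lambda>_. 0)"
  by (simp add: has_weak_dbar_def loc_integrable_def set_integrable_def)

lemma has_weak_dbar_sum:
  "finite I \<Longrightarrow> (\<And>i. i \<in> I \<Longrightarrow> has_weak_dbar (f i) (h i)) \<Longrightarrow>
    has_weak_dbar (\<lambda>z. \<Sum>i\<in>I. f i z) (\<lambda>z. \<Sum>i\<in>I. h i z)"
  by (induction I rule: finite_induct) (simp_all add: has_weak_dbar_0 has_weak_dbar_add)

text \<open>The Leibniz rule is moved to the test function:
  \<open>\<rho> \<partial>\<bar>\<phi> = \<partial>\<bar>(\<rho> \<phi>) - \<phi> \<partial>\<bar>\<rho>\<close>, where \<open>\<rho> \<phi>\<close> is again a test function.\<close>

lemma has_weak_dbar_mult_smooth: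
  assumes f: "has_weak_dbar f h" and \<rho>: "\<And>m. C_diff m \<rho>"
  shows "has_weak_dbar (\<lambda>z. \<rho> z *\<^sub>R f z) (\<lambda>z. \<rho> z *\<^sub>R h z + dbar \<rho> z * f z)"
  unfolding has_weak_dbar_def
proof (intro conjI allI impI)
  have li: "loc_integrable f" "loc_integrable h" using f by (auto simp: has_weak_dbar_def)
  have "continuous_on UNIV \<rho>" using \<rho> C_diff_imp_continuous_on by blast
  then have li': "loc_integrable (\<lambda>z. \<rho> z *\<^sub>R f z)" "loc_integrable (\<lambda>z. \<rho> z *\<^sub>R h z)"
    using loc_integrable_bilinear[OF bounded_bilinear_scaleR] li by blast+
  have li'': "loc_integrable (\<lambda>z. dbar \<rho> z * f z)"
    by (rule loc_integrable_bilinear[OF bounded_bilinear_bicomplex_mult continuous_on_dbar[OF \<rho>] li(1)])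
  show "loc_integrable (\<lambda>z. \<rho> z *\<^sub>R f z)" "loc_integrable (\<lambda>z. \<rho> z *\<^sub>R h z + dbar \<rho> z * f z)"
    using li' li'' by (simp_all add: loc_integrable_add)
  fix \<phi> assume \<phi>: "test_function \<phi>"
  have diff: "\<phi> differentiable at z" "\<rho> differentiable at z" for z
    using \<phi> \<rho>[of 1] C_diff.simps(2)[of 0 \<phi>] unfolding test_function_def
    by (metis One_nat_def C_diff.simps(2))+
  have \<rho>\<phi>: "test_function (\<lambda>z. \<rho> z * \<phi> z)" by (rule test_function_mult[OF \<phi> \<rho>])
  have "dbar \<phi> z * (\<rho> z *\<^sub>R f z) = dbar (\<lambda>z. \<rho> z * \<phi> z) z * f z - \<phi> z *\<^sub>R (dbar \<rho> z * f z)" for z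
    by (simp add: dbar_mult[OF diff(2,1)] distrib_right)
  then have "(LINT z:udisk|lebesgue. dbar \<phi> z * (\<rho> z *\<^sub>R f z)) =
      (LINT z:udisk|lebesgue. dbar (\<lambda>z. \<rho> z * \<phi> z) z * f z) -
      (LINT z:udisk|lebesgue. \<phi> z *\<^sub>R (dbar \<rho> z * f z))"
    using integrable_test(2)[OF \<rho>\<phi> li(1)] integrable_test(1)[OF \<phi> li'']
    by (simp add: set_integral_diff)
  also have "\<dots> = - (LINT z:udisk|lebesgue. \<phi> z *\<^sub>R (\<rho> z *\<^sub>R h z)) -
      (LINT z:udisk|lebesgue. \<phi> z *\<^sub>R (dbar \<rho> z * f z))"
    using f \<rho>\<phi> by (simp add: has_weak_dbar_def mult.commute)
  also have "\<dots> = - (LINT z:udisk|lebesgue. \<phi> z *\<^sub>R (\<rho> z *\<^sub>R h z + dbar \<rho> z * f z))"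
    using integrable_test(1)[OF \<phi> li'(2)] integrable_test(1)[OF \<phi> li'']
    by (simp add: scaleR_add_right set_integral_add)
  finally show "(LINT z:udisk|lebesgue. dbar \<phi> z * (\<rho> z *\<^sub>R f z)) =
      - (LINT z:udisk|lebesgue. \<phi> z *\<^sub>R (\<rho> z *\<^sub>R h z + dbar \<rho> z * f z))" .
qed

lemma vekua_op_cong:
  assumes "\<And>z. z \<in> udisk \<Longrightarrow> f z = f' z" "\<And>z. z \<in> udisk \<Longrightarrow> g z = g' z"
  shows "vekua_op A B f g \<longleftrightarrow> vekua_op A B f' g'"
  unfolding vekua_op_def using assms by (intro has_weak_dbar_cong) simp_all

text \<open>The difference \<open>g - g'\<close> is a weak \<open>\<partial>\<bar>\<close>-derivative of 0, hence orthogonal to all test functions.\<close>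

lemma vekua_op_unique:
  assumes "vekua_op A B f g" "vekua_op A B f g'"
    and "continuous_on udisk g" "continuous_on udisk g'" "z \<in> udisk"
  shows "g z = g' z"
proof -
  have "has_weak_dbar (\<lambda>z. f z + (-1) *\<^sub>R f z)
      (\<lambda>z. (g z + A z * f z + B z * bccnj (f z)) + (-1) *\<^sub>R (g' z + A z * f z + B z * bccnj (f z)))"
    using assms(1,2) unfolding vekua_op_def by (intro has_weak_dbar_add has_weak_dbar_scaleR)
  then have "has_weak_dbar (\<lambda>_. 0) (\<lambda>z. g z - g' z)" by simp
  then have "loc_integrable (\<lambda>z. g z - g' z)"
    "\<And>\<phi>. test_function \<phi> \<Longrightarrow> (LINT z:udisk|lebesgue. \<phi> z *\<^sub>R (g z - g' z)) = 0"
    by (simp_all add: has_weak_dbar_def)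
  from continuous_eq_0_if_test_integrals_0[OF _ this assms(5)] assms(3,4) show ?thesis
    by (simp add: continuous_on_diff)
qed

lemma dbar_power_2Re: "dbar (\<lambda>z. (2 * Re z) ^ k) z = of_real (real k * (2 * Re z) ^ (k - 1))"
proof -
  have "((\<lambda>z. 2 * Re z) has_derivative (\<lambda>h. 2 * Re h)) (at z)"
    by (auto intro!: derivative_eq_intros)
  from has_derivative_power[OF this, of k]
  have "((\<lambda>z. (2 * Re z) ^ k) has_derivative
      (\<lambda>h. real k * (2 * Re z) ^ (k - 1) * (2 * Re h))) (at z)"
    by (simp add: mult_ac)
  from dx_eqI[OF this] dy_eqI[OF this] show ?thesis
    by (simp add: dbar_def scaleR_conv_of_real flip: of_real_mult)
qed

lemma C_diff_2Re: "C_diff m (\<lambda>z. 2 * Re z)"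
  by (intro C_diff_mult C_diff_const C_diff_Re)

lemma bccnj_scaleR: "bccnj (r *\<^sub>R w) = r *\<^sub>R bccnj w"
  and bccnj_add: "bccnj (w + v) = bccnj w + bccnj v"
  and bccnj_0: "bccnj 0 = 0"
  by (simp_all add: bccnj_def bicomplex_eq_iff)

lemma bccnj_sum: "bccnj (\<Sum>i\<in>I. w i) = (\<Sum>i\<in>I. bccnj (w i))"
  by (induction I rule: infinite_finite_induct) (simp_all add: bccnj_0 bccnj_add)

text \<open>In \<open>\<partial>\<bar>((2 x)\<^sup>k \<phi>)\<close> the derivative of \<open>\<phi>\<close> contributes exactly the terms with \<open>A\<close> and \<open>B\<close> for \<open>(2 x)\<^sup>k \<phi>\<close>,
  because real factors pass through the conjugation; what remains is the derivative of \<open>(2 x)\<^sup>k\<close>.\<close>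

lemma vekua_op_mult_power_2Re:
  assumes "\<phi> \<in> H_space A B"
  shows "vekua_op A B (\<lambda>z. (2 * Re z) ^ k *\<^sub>R \<phi> z) (\<lambda>z. (real k * (2 * Re z) ^ (k - 1)) *\<^sub>R \<phi> z)"
proof -
  have "has_weak_dbar \<phi> (\<lambda>z. A z * \<phi> z + B z * bccnj (\<phi> z))"
    using assms by (simp add: H_space_def)
  from has_weak_dbar_mult_smooth[OF this C_diff_power[OF C_diff_2Re, of _ k]]
  show ?thesis
    unfolding vekua_op_def dbar_power_2Re
    by (simp add: bccnj_scaleR scaleR_add_right scaleR_conv_of_real[symmetric] add_ac)
      (simp add: scaleR_conv_of_real)
qed

lemma vekua_op_scaleR_sum:
  assumes "finite I" "\<And>i. i \<in> I \<Longrightarrow> vekua_op A B (f i) (g i)"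
  shows "vekua_op A B (\<lambda>z. \<Sum>i\<in>I. c i *\<^sub>R f i z) (\<lambda>z. \<Sum>i\<in>I. c i *\<^sub>R g i z)"
proof -
  have "has_weak_dbar (\<lambda>z. \<Sum>i\<in>I. c i *\<^sub>R f i z)
      (\<lambda>z. \<Sum>i\<in>I. c i *\<^sub>R (g i z + A z * f i z + B z * bccnj (f i z)))"
    using assms unfolding vekua_op_def by (intro has_weak_dbar_sum has_weak_dbar_scaleR)
  then show ?thesis
    by (simp add: vekua_op_def bccnj_sum bccnj_scaleR sum_distrib_left sum.distrib scaleR_add_right)
qed

text \<open>The \<open>m\<close>-th formal derivative, in the variable \<open>2 x\<close>, of the polynomial with the coefficients
  \<open>\<phi> 0, \<dots>, \<phi> (n - 1)\<close>; it vanishes for \<open>m \<ge> n\<close>.\<close>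

definition vekua_iterate :: "nat \<Rightarrow> (nat \<Rightarrow> complex \<Rightarrow> bicomplex) \<Rightarrow> nat \<Rightarrow> complex \<Rightarrow> bicomplex" where
  "vekua_iterate n \<phi> m z = (\<Sum>k<n - m. (fact (k + m) / fact k) *\<^sub>R ((2 * Re z) ^ k *\<^sub>R \<phi> (k + m) z))"

lemma vekua_op_iterate:
  assumes "\<And>k. k < n \<Longrightarrow> \<phi> k \<in> H_space A B" "m < n"
  shows "vekua_op A B (vekua_iterate n \<phi> m) (vekua_iterate n \<phi> (Suc m))"
proof -
  have "vekua_op A B (\<lambda>z. \<Sum>k<n - m. (fact (k + m) / fact k) *\<^sub>R ((2 * Re z) ^ k *\<^sub>R \<phi> (k + m) z))
      (\<lambda>z. \<Sum>k<n - m. (fact (k + m) / fact k) *\<^sub>R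
        ((real k * (2 * Re z) ^ (k - 1)) *\<^sub>R \<phi> (k + m) z))" (is "vekua_op A B _ ?g")
    by (intro vekua_op_scaleR_sum vekua_op_mult_power_2Re assms(1)) auto
  moreover have "?g = vekua_iterate n \<phi> (Suc m)"
  proof
    fix z
    \<comment> \<open>The summand with \<open>k = 0\<close> vanishes, and the others are shifted by one.\<close>
    have "n - m = Suc (n - Suc m)" using assms(2) by simp
    then show "?g z = vekua_iterate n \<phi> (Suc m) z"
      unfolding vekua_iterate_def by (simp only: sum.lessThan_Suc_shift) (simp add: mult_ac)
  qed
  moreover have "vekua_iterate n \<phi> m = (\<lambda>z.
      \<Sum>k<n - m. (fact (k + m) / fact k) *\<^sub>R ((2 * Re z) ^ k *\<^sub>R \<phi> (k + m) z))"
    by (simp add: vekua_iterate_def fun_eq_iff)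
  ultimately show ?thesis by simp
qed

lemma continuous_on_vekua_iterate:
  assumes "\<And>k. k < n \<Longrightarrow> continuous_on udisk (\<phi> k)"
  shows "continuous_on udisk (vekua_iterate n \<phi> m)"
  unfolding vekua_iterate_def[abs_def] using assms by (auto intro!: continuous_intros)

lemma vekua_iterate_0:
  "vekua_iterate n \<phi> 0 z = (\<Sum>k<n. (bchat z + bchat (cnj z)) ^ k * \<phi> k z)"
proof -
  have "bchat z + bchat (cnj z) = of_real (2 * Re z)"
    by (simp add: bchat_def bicomplex_eq_iff of_real_def complex_eq_iff)
  then show ?thesis by (simp add: vekua_iterate_def scaleR_conv_of_real)
qed

section \<open>Finiteness of Hardy norms\<close>

text \<open>Taking the \<open>p\<close>-th root does not matter for finiteness; without it, the integrals can be added
  for every positive \<open>p\<close>.\<close>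

lemma Hp_norm_finite_iff:
  assumes "0 < p"
  shows "Hp_norm p f < \<infinity> \<longleftrightarrow> (\<exists>C<\<infinity>. \<forall>r\<in>{0<..<1}.
    (\<integral>\<^sup>+\<theta>\<in>{0..2*pi}. ennreal (norm (f (of_real r * cis \<theta>)) powr p) \<partial>lborel) \<le> C)"
    (is "_ \<longleftrightarrow> (\<exists>C<\<infinity>. \<forall>r\<in>_. ?I r \<le> C)")
proof
  assume *: "Hp_norm p f < \<infinity>"
  define M where "M = enn2real (Hp_norm p f)"
  have "?I r \<le> ennreal (M powr p)" if "r \<in> {0<..<1}" for r
  proof -
    have "ennreal_powr (?I r) (1/p) \<le> Hp_norm p f"
      unfolding Hp_norm_def using that by (rule SUP_upper)
    also have "\<dots> = ennreal M" using * by (simp add: M_def)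
    finally have le: "ennreal_powr (?I r) (1/p) \<le> ennreal M" .
    have fin: "?I r \<noteq> \<infinity>"
      using le by (auto simp: ennreal_powr_def top_unique)
    then have "enn2real (?I r) powr (1/p) \<le> M"
      using le unfolding ennreal_powr_def by (simp add: M_def)
    then have "(enn2real (?I r) powr (1/p)) powr p \<le> M powr p"
      using assms by (intro powr_mono2) auto
    then have "enn2real (?I r) \<le> M powr p" using assms by (simp add: powr_powr)
    then show ?thesis using fin by (metis ennreal_enn2real_if ennreal_leI infinity_ennreal_def)
  qed
  then show "\<exists>C<\<infinity>. \<forall>r\<in>{0<..<1}. ?I r \<le> C"
    by (intro exI[of _ "ennreal (M powr p)"]) auto
next
  assume "\<exists>C<\<infinity>. \<forall>r\<in>{0<..<1}. ?I r \<le> C"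
  then obtain C where C: "C < \<infinity>" "\<And>r. r \<in> {0<..<1} \<Longrightarrow> ?I r \<le> C" by blast
  have "ennreal_powr (?I r) (1/p) \<le> ennreal (enn2real C powr (1/p))" if "r \<in> {0<..<1}" for r
  proof -
    have fin: "?I r \<noteq> \<infinity>" using C(1) C(2)[OF that] by (auto simp: top_unique)
    have "enn2real (?I r) \<le> enn2real C" using C(1) C(2)[OF that] by (simp add: enn2real_mono)
    then show ?thesis using fin assms by (auto simp: ennreal_powr_def intro!: ennreal_leI powr_mono2)
  qed
  then have "Hp_norm p f \<le> ennreal (enn2real C powr (1/p))"
    unfolding Hp_norm_def by (intro SUP_least)
  then show "Hp_norm p f < \<infinity>" by (simp add: le_less_trans)
qed

lemma circle_in_udisk: "r \<in> {0<..<1} \<Longrightarrow> of_real r * cis \<theta> \<in> udisk"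
  by (simp add: norm_mult)

lemma Hp_norm_cong: "(\<And>z. z \<in> udisk \<Longrightarrow> f z = g z) \<Longrightarrow> Hp_norm p f = Hp_norm p g"
  unfolding Hp_norm_def using circle_in_udisk by (intro SUP_cong refl) simp

lemma measurable_circle:
  assumes "continuous_on udisk f" "r \<in> {0<..<1}"
  shows "(\<lambda>\<theta>. ennreal (norm (f (of_real r * cis \<theta>) :: bicomplex) powr p)) \<in> borel_measurable lborel"
proof -
  have "continuous_on UNIV (\<lambda>\<theta>. f (of_real r * cis \<theta>))"
    by (rule continuous_on_compose2[OF assms(1)])
      (use circle_in_udisk[OF assms(2)] in \<open>auto intro!: continuous_intros continuous_on_cis\<close>)
  then have "(\<lambda>\<theta>. f (of_real r * cis \<theta>)) \<in> borel_measurable borel"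
    by (rule borel_measurable_continuous_onI)
  then show ?thesis by simp
qed

text \<open>A substitute for Minkowski's inequality that holds for \<open>p < 1\<close>, too.\<close>

lemma norm_add_powr_le:
  fixes a b :: "'a::real_normed_vector"
  assumes "0 < p"
  shows "norm (a + b) powr p \<le> 2 powr p * (norm a powr p + norm b powr p)"
proof -
  have "norm (a + b) \<le> 2 * max (norm a) (norm b)"
    using norm_triangle_ineq[of a b] by linarith
  then have "norm (a + b) powr p \<le> (2 * max (norm a) (norm b)) powr p"
    using assms by (intro powr_mono2) auto
  also have "\<dots> = 2 powr p * max (norm a) (norm b) powr p"
    by (subst powr_mult) auto
  also have "\<dots> \<le> 2 powr p * (norm a powr p + norm b powr p)"
    by (intro mult_left_mono) (auto simp: max_def)
  finally show ?thesis .
qed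

lemma Hp_norm_add_finite:
  assumes "0 < p" "continuous_on udisk f" "continuous_on udisk g"
    and "Hp_norm p f < \<infinity>" "Hp_norm p g < \<infinity>"
  shows "Hp_norm p (\<lambda>z. f z + g z) < \<infinity>"
proof -
  let ?I = "\<lambda>f r. \<integral>\<^sup>+\<theta>\<in>{0..2*pi}. ennreal (norm (f (of_real r * cis \<theta>) :: bicomplex) powr p) \<partial>lborel"
  obtain C D where C: "C < \<infinity>" "\<And>r. r \<in> {0<..<1} \<Longrightarrow> ?I f r \<le> C"
    and D: "D < \<infinity>" "\<And>r. r \<in> {0<..<1} \<Longrightarrow> ?I g r \<le> D"
    using assms(4,5) unfolding Hp_norm_finite_iff[OF assms(1)] by blast
  have "?I (\<lambda>z. f z + g z) r \<le> ennreal (2 powr p) * (C + D)" if r: "r \<in> {0<..<1}" for r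
  proof -
    note [measurable] = measurable_circle[OF assms(2) r] measurable_circle[OF assms(3) r]
    let ?f = "\<lambda>\<theta>. ennreal (norm (f (of_real r * cis \<theta>)) powr p)"
    let ?g = "\<lambda>\<theta>. ennreal (norm (g (of_real r * cis \<theta>)) powr p)"
    have "?I (\<lambda>z. f z + g z) r \<le> (\<integral>\<^sup>+\<theta>. ennreal (2 powr p) *
        (?f \<theta> * indicator {0..2*pi} \<theta> + ?g \<theta> * indicator {0..2*pi} \<theta>) \<partial>lborel)"
      using norm_add_powr_le[OF assms(1)]
      by (intro nn_integral_mono)
        (auto simp: indicator_def simp flip: ennreal_plus ennreal_mult intro!: ennreal_leI)
    also have "\<dots> = ennreal (2 powr p) * (?I f r + ?I g r)"
      by (simp add: nn_integral_cmult nn_integral_add)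
    also have "\<dots> \<le> ennreal (2 powr p) * (C + D)"
      using C(2) D(2) r by (intro mult_left_mono add_mono) auto
    finally show ?thesis .
  qed
  moreover have "ennreal (2 powr p) * (C + D) < \<infinity>"
    using C(1) D(1) by (simp add: ennreal_mult_less_top)
  ultimately show ?thesis unfolding Hp_norm_finite_iff[OF assms(1)] by blast
qed

lemma Hp_norm_mult_bounded_finite:
  assumes "0 < p" "continuous_on udisk f" "Hp_norm p f < \<infinity>"
    and "\<And>z. z \<in> udisk \<Longrightarrow> \<bar>c z\<bar> \<le> K"
  shows "Hp_norm p (\<lambda>z. c z *\<^sub>R f z) < \<infinity>"
proof -
  let ?I = "\<lambda>f r. \<integral>\<^sup>+\<theta>\<in>{0..2*pi}. ennreal (norm (f (of_real r * cis \<theta>) :: bicomplex) powr p) \<partial>lborel"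
  obtain C where C: "C < \<infinity>" "\<And>r. r \<in> {0<..<1} \<Longrightarrow> ?I f r \<le> C"
    using assms(3) unfolding Hp_norm_finite_iff[OF assms(1)] by blast
  have le: "norm (c z *\<^sub>R f z) powr p \<le> K powr p * norm (f z) powr p" if "z \<in> udisk" for z
  proof -
    have "0 \<le> K" using assms(4)[OF that] by linarith
    moreover have "norm (c z *\<^sub>R f z) \<le> K * norm (f z)"
      using assms(4)[OF that] by (simp add: mult_right_mono)
    ultimately show ?thesis
      using assms(1) powr_mono2[of p "norm (c z *\<^sub>R f z)" "K * norm (f z)"] by (simp add: powr_mult)
  qed
  have "?I (\<lambda>z. c z *\<^sub>R f z) r \<le> ennreal (K powr p) * C" if r: "r \<in> {0<..<1}" for r
  proof -
    note [measurable] = measurable_circle[OF assms(2) r]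
    let ?f = "\<lambda>\<theta>. ennreal (norm (f (of_real r * cis \<theta>)) powr p)"
    have "?I (\<lambda>z. c z *\<^sub>R f z) r \<le>
        (\<integral>\<^sup>+\<theta>. ennreal (K powr p) * (?f \<theta> * indicator {0..2*pi} \<theta>) \<partial>lborel)"
      using le[OF circle_in_udisk[OF r]]
      by (intro nn_integral_mono)
        (auto simp: indicator_def simp flip: ennreal_mult intro!: ennreal_leI)
    also have "\<dots> = ennreal (K powr p) * ?I f r"
      by (simp add: nn_integral_cmult)
    also have "\<dots> \<le> ennreal (K powr p) * C"
      using C(2) r by (intro mult_left_mono) auto
    finally show ?thesis .
  qed
  moreover have "ennreal (K powr p) * C < \<infinity>"
    using C(1) by (simp add: ennreal_mult_less_top)
  ultimately show ?thesis unfolding Hp_norm_finite_iff[OF assms(1)] by blast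
qed

lemma Hp_norm_sum_finite:
  assumes "0 < p" "finite I" "\<And>k. k \<in> I \<Longrightarrow> continuous_on udisk (f k)"
    and "\<And>k. k \<in> I \<Longrightarrow> Hp_norm p (f k) < \<infinity>"
  shows "Hp_norm p (\<lambda>z. \<Sum>k\<in>I. a k *\<^sub>R ((2 * Re z) ^ e k *\<^sub>R f k z)) < \<infinity>"
  using assms(2-4)
proof (induction I rule: finite_induct)
  case empty
  have "Hp_norm p (\<lambda>_. 0) < \<infinity>"
    unfolding Hp_norm_finite_iff[OF assms(1)] using assms(1) by (intro exI[of _ 0]) simp
  then show ?case by simp
next
  case (insert i I)
  have "\<bar>a i * (2 * Re z) ^ e i\<bar> \<le> \<bar>a i\<bar> * 2 ^ e i" if "z \<in> udisk" for z
  proof -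
    have "\<bar>2 * Re z\<bar> \<le> 2" using that abs_Re_le_cmod[of z] by simp
    then have "\<bar>2 * Re z\<bar> ^ e i \<le> 2 ^ e i" by (rule power_mono) simp
    then have "\<bar>a i\<bar> * \<bar>2 * Re z\<bar> ^ e i \<le> \<bar>a i\<bar> * 2 ^ e i" by (rule mult_left_mono) simp
    then show ?thesis by (simp only: abs_mult power_abs)
  qed
  then have "Hp_norm p (\<lambda>z. (a i * (2 * Re z) ^ e i) *\<^sub>R f i z) < \<infinity>"
    using insert.prems by (intro Hp_norm_mult_bounded_finite[OF assms(1)]) auto
  then have "Hp_norm p (\<lambda>z. a i *\<^sub>R ((2 * Re z) ^ e i *\<^sub>R f i z)) < \<infinity>" by simp
  moreover have "Hp_norm p (\<lambda>z. \<Sum>k\<in>I. a k *\<^sub>R ((2 * Re z) ^ e k *\<^sub>R f k z)) < \<infinity>"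
    using insert by auto
  moreover have "continuous_on udisk (\<lambda>z. \<Sum>k\<in>J. a k *\<^sub>R ((2 * Re z) ^ e k *\<^sub>R f k z))"
    if "J \<subseteq> insert i I" for J
    using insert.prems(1) that by (intro continuous_intros) auto
  from this[of I] this[of "{i}"] have
    "continuous_on udisk (\<lambda>z. \<Sum>k\<in>I. a k *\<^sub>R ((2 * Re z) ^ e k *\<^sub>R f k z))"
    "continuous_on udisk (\<lambda>z. a i *\<^sub>R ((2 * Re z) ^ e i *\<^sub>R f i z))"
    by auto
  ultimately have "Hp_norm p (\<lambda>z. a i *\<^sub>R ((2 * Re z) ^ e i *\<^sub>R f i z) +
      (\<Sum>k\<in>I. a k *\<^sub>R ((2 * Re z) ^ e k *\<^sub>R f k z))) < \<infinity>"
    by (intro Hp_norm_add_finite assms(1))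
  then show ?case using insert.hyps by simp
qed

text \<open>The triangular system is solved backwards, starting from \<open>\<phi> (n - 1)\<close>: the lowest coefficient of
  the \<open>m\<close>-th iterate is \<open>m! \<phi> m\<close>, and its other coefficients only involve \<open>\<phi> k\<close> with \<open>k > m\<close>.\<close>

lemma Hp_norm_vekua_iterate_finite_iff:
  assumes "0 < p" and cont: "\<And>k. k < n \<Longrightarrow> continuous_on udisk (\<phi> k)"
  shows "(\<forall>m<n. Hp_norm p (vekua_iterate n \<phi> m) < \<infinity>) \<longleftrightarrow> (\<forall>k<n. Hp_norm p (\<phi> k) < \<infinity>)"
proof
  assume "\<forall>k<n. Hp_norm p (\<phi> k) < \<infinity>"
  then show "\<forall>m<n. Hp_norm p (vekua_iterate n \<phi> m) < \<infinity>"
    unfolding vekua_iterate_def[abs_def]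
    by (intro allI impI Hp_norm_sum_finite assms) auto
next
  assume G: "\<forall>m<n. Hp_norm p (vekua_iterate n \<phi> m) < \<infinity>"
  have "Hp_norm p (\<phi> m) < \<infinity>" if "m < n" for m
    using that
  proof (induction "n - m" arbitrary: m rule: less_induct)
    case less
    define R where "R z = (\<Sum>k<n - Suc m. (- (fact (Suc k + m) / fact (Suc k))) *\<^sub>R
      ((2 * Re z) ^ Suc k *\<^sub>R \<phi> (Suc k + m) z))" for z
    have "n - m = Suc (n - Suc m)" using less.prems by simp
    then have split: "fact m *\<^sub>R \<phi> m z = vekua_iterate n \<phi> m z + R z" for z
      unfolding vekua_iterate_def R_def
      by (simp only: sum.lessThan_Suc_shift scaleR_minus_left sum_negf) simp
    have "\<phi> m z = (1 / fact m) *\<^sub>R (vekua_iterate n \<phi> m z + R z)" for z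
      by (simp flip: split)
    then have eq: "\<phi> m = (\<lambda>z. (1 / fact m) *\<^sub>R (vekua_iterate n \<phi> m z + R z))" by blast
    have "Hp_norm p R < \<infinity>"
      unfolding R_def using less by (intro Hp_norm_sum_finite assms) auto
    moreover have contR: "continuous_on udisk R"
      unfolding R_def by (intro continuous_intros cont) auto
    moreover have contG: "continuous_on udisk (vekua_iterate n \<phi> m)"
      by (rule continuous_on_vekua_iterate[OF cont])
    ultimately have "Hp_norm p (\<lambda>z. vekua_iterate n \<phi> m z + R z) < \<infinity>"
      using G less.prems by (intro Hp_norm_add_finite assms(1)) auto
    then have "Hp_norm p (\<lambda>z. (1 / fact m) *\<^sub>R (vekua_iterate n \<phi> m z + R z)) < \<infinity>"
      using contR contG by (intro Hp_norm_mult_bounded_finite[OF assms(1)] continuous_intros) auto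
    then show ?case using eq by metis
  qed
  then show "\<forall>k<n. Hp_norm p (\<phi> k) < \<infinity>" by blast
qed

section \<open>Sums of powers times solutions in the iterated Hardy class\<close>

theorem theorem6p9:
  fixes p q :: real and n :: nat
    and A B f :: "complex \<Rightarrow> bicomplex" and \<phi> :: "nat \<Rightarrow> complex \<Rightarrow> bicomplex"
  assumes "0 < p" and "0 < n" and "2 < q"
    and "A \<in> Sobolev_bc (n - 1) q" and "B \<in> Sobolev_bc (n - 1) q"
    and "\<And>k. k < n \<Longrightarrow> \<phi> k \<in> H_space A B"
    and "\<And>z. z \<in> udisk \<Longrightarrow> f z = (\<Sum>k<n. (bchat z + bchat (cnj z)) ^ k * \<phi> k z)"
  shows "f \<in> V_space n p A B \<longleftrightarrow> (\<forall>k<n. \<phi> k \<in> Hp_space p A B)"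
proof -
  let ?G = "vekua_iterate n \<phi>"
  have cont: "continuous_on udisk (\<phi> k)" if "k < n" for k
    using assms(6)[OF that] by (simp add: H_space_def)
  have contG: "continuous_on udisk (?G m)" for m
    by (rule continuous_on_vekua_iterate[OF cont])
  have G0: "?G 0 z = f z" if "z \<in> udisk" for z
    using assms(7)[OF that] by (simp add: vekua_iterate_0)
  have step: "vekua_op A B (?G m) (?G (Suc m))" if "m < n" for m
    by (rule vekua_op_iterate[OF assms(6) that])
  have "f \<in> V_space n p A B \<longleftrightarrow> (\<forall>m<n. Hp_norm p (?G m) < \<infinity>)"
  proof
    assume "f \<in> V_space n p A B"
    then obtain g where g0: "\<And>z. z \<in> udisk \<Longrightarrow> g 0 z = f z"
      and g: "\<And>k. k < n \<Longrightarrow> continuous_on udisk (g k)"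
        "\<And>k. k < n \<Longrightarrow> vekua_op A B (g k) (g (Suc k))"
      and fin: "(\<Sum>k<n. Hp_norm p (g k)) < \<infinity>"
      unfolding V_space_def by blast
    have "g m z = ?G m z" if "m < n" "z \<in> udisk" for m z
      using that
    proof (induction m arbitrary: z)
      case 0
      then show ?case using g0 G0 by simp
    next
      case (Suc m)
      have "vekua_op A B (?G m) (g (Suc m))"
        using g(2)[of m] Suc vekua_op_cong[of "g m" "?G m" "g (Suc m)" "g (Suc m)"] by simp
      then show ?case
        using vekua_op_unique step g(1) contG Suc.prems Suc_lessD by blast
    qed
    then have "Hp_norm p (g m) = Hp_norm p (?G m)" if "m < n" for m
      using that by (intro Hp_norm_cong) simp
    then show "\<forall>m<n. Hp_norm p (?G m) < \<infinity>"
      using fin by simp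
  next
    assume "\<forall>m<n. Hp_norm p (?G m) < \<infinity>"
    moreover have "?G n z = 0" for z by (simp add: vekua_iterate_def)
    ultimately show "f \<in> V_space n p A B"
      unfolding V_space_def using G0 step contG
      by (intro CollectI exI[of _ ?G]) simp
  qed
  also have "\<dots> \<longleftrightarrow> (\<forall>k<n. Hp_norm p (\<phi> k) < \<infinity>)"
    by (rule Hp_norm_vekua_iterate_finite_iff[OF assms(1) cont])
  also have "\<dots> \<longleftrightarrow> (\<forall>k<n. \<phi> k \<in> Hp_space p A B)"
    using assms(6) by (simp add: Hp_space_def)
  finally show ?thesis .
qed

end
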